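(* Let $\alpha\in(0,\frac13)$, let $K_\alpha$ be the stretched Sierpinski gasket with maps $F_1,F_2,F_3$ as in the context, and let $d_\alpha=\frac{\log3}{\log2-\log(1-\alpha)}$. The $d_\alpha$-dimensional Hausdorff measure on $K_\alpha$ satisfies $$\mathcal H^{d_\alpha}(A)=\frac13\sum_{i=1}^3\mathcal H^{d_\alpha}\big(F_i^{-1}(A)\big)$$ for any Borel set $A\subseteq K_\alpha$.
   Context: **Stretched Sierpinski gasket.** Fix $\alpha\in(0,\frac13)$. Let $p_1=(0,0)$, $p_2=(\frac12,\frac{\sqrt3}2)$, $p_3=(1,0)$, $p_4=\frac{p_2+p_3}2$, $p_5=\frac{p_1+p_3}2$, $p_6=\frac{p_1+p_2}2$; $A_1=A_2=A_3=\frac{1-\alpha}2 I_2$, $A_4=\frac\alpha4\begin{pmatrix}1&-\sqrt3\\-\sqrt3&3\end{pmatrix}$, $A_5=\alpha\begin{pmatrix}1&0\\0&0\end{pmatrix}$, $A_6=\frac\alpha4\begin{pmatrix}1&\sqrt3\\\sqrt3&3\end{pmatrix}$; $F_j(x)=A_j(x-p_j)+p_j$ on $\mathbb R^2$, $j=1,\dots,6$. $K_\alpha$ is the unique nonempty compact set with $K_\alpha=\bigcup_{j=1}^6F_j(K_\alpha)$. The number $d_\alpha$ is the Hausdorff dimension of $K_\alpha$. The maps $F_i$ are regarded as maps $K_\alpha\to K_\alpha$, so $F_i^{-1}(A)=\{x\in K_\alpha:F_i(x)\in A\}$. *)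

theory Defs
  imports "HOL-Analysis.Analysis"
begin

section \<open>Hausdorff measure\<close>

text \<open>The conventions are that the empty set contributes 0 and, in dimension 0, every nonempty set
  contributes 1 (whereas \<open>0 powr 0 = 0\<close>).\<close>

definition diameter_pow :: "real \<Rightarrow> 'a::metric_space set \<Rightarrow> ennreal" where
  "diameter_pow s U =
     (if U = {} then 0 else if s = 0 then 1 else ennreal (diameter U powr s))"

text \<open>Covers consist of bounded sets because \<open>diameter\<close> is unspecified on unbounded ones.
  Countable covers are indexed by \<open>nat\<close>; finite ones are padded with the empty set.\<close>

definition hausdorff_premeasure :: "real \<Rightarrow> real \<Rightarrow> 'a::metric_space set \<Rightarrow> ennreal" where
  "hausdorff_premeasure s \<delta> A =
     (INF U\<in>{U :: nat \<Rightarrow> 'a set. A \<subseteq> (\<Union>i. U i) \<and> (\<forall>i. bounded (U i) \<and> diameter (U i) \<le> \<delta>)}.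
        \<Sum>i. diameter_pow s (U i))"

text \<open>The unnormalised \<open>s\<close>-dimensional Hausdorff (outer) measure.\<close>

definition hausdorff_measure :: "real \<Rightarrow> 'a::metric_space set \<Rightarrow> ennreal" where
  "hausdorff_measure s A = (SUP \<delta>\<in>{0<..}. hausdorff_premeasure s \<delta> A)"

section \<open>The stretched Sierpinski gasket\<close>

text \<open>The indices range over \<open>{1..6}\<close>; values at other indices are irrelevant.\<close>

definition gasket_point :: "nat \<Rightarrow> real^2" where
  "gasket_point j =
     (let p1 = vector [0, 0]; p2 = vector [1/2, sqrt 3 / 2]; p3 = vector [1, 0] in
      if j = 1 then p1
      else if j = 2 then p2
      else if j = 3 then p3
      else if j = 4 then (1/2) *\<^sub>R (p2 + p3)
      else if j = 5 then (1/2) *\<^sub>R (p1 + p3)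
      else (1/2) *\<^sub>R (p1 + p2))"

definition gasket_matrix :: "real \<Rightarrow> nat \<Rightarrow> real^2^2" where
  "gasket_matrix \<alpha> j =
     (if j = 1 \<or> j = 2 \<or> j = 3 then ((1 - \<alpha>) / 2) *\<^sub>R mat 1
      else if j = 4 then (\<alpha> / 4) *\<^sub>R vector [vector [1, - sqrt 3], vector [- sqrt 3, 3]]
      else if j = 5 then \<alpha> *\<^sub>R vector [vector [1, 0], vector [0, 0]]
      else (\<alpha> / 4) *\<^sub>R vector [vector [1, sqrt 3], vector [sqrt 3, 3]])"

definition gasket_map :: "real \<Rightarrow> nat \<Rightarrow> real^2 \<Rightarrow> real^2" where
  "gasket_map \<alpha> j x = gasket_matrix \<alpha> j *v (x - gasket_point j) + gasket_point j"

definition stretched_gasket :: "real \<Rightarrow> (real^2) set" where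
  "stretched_gasket \<alpha> =
     (THE K. compact K \<and> K \<noteq> {} \<and> K = (\<Union>j\<in>{1..6}. gasket_map \<alpha> j ` K))"

definition gasket_dim :: "real \<Rightarrow> real" where
  "gasket_dim \<alpha> = ln 3 / (ln 2 - ln (1 - \<alpha>))"

subsection \<open>The gasket is well defined\<close>

lemma ifs_attractor_subset:
  fixes f :: "'i \<Rightarrow> 'a::euclidean_space \<Rightarrow> 'a"
  assumes c: "c < 1"
    and lip: "\<And>j x y. j \<in> J \<Longrightarrow> dist (f j x) (f j y) \<le> c * dist x y"
    and K: "compact K" "K \<noteq> {}" "K = (\<Union>j\<in>J. f j ` K)"
    and L: "compact L" "L \<noteq> {}" "L = (\<Union>j\<in>J. f j ` L)"
  shows "K \<subseteq> L"
proof -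
  have "continuous_on K (\<lambda>x. infdist x L)"
    by (intro continuous_intros)
  then obtain x where x: "x \<in> K" "\<And>z. z \<in> K \<Longrightarrow> infdist z L \<le> infdist x L"
    using continuous_attains_sup[OF K(1,2), of "\<lambda>x. infdist x L"] by blast
  from x(1) K(3) obtain j k where j: "j \<in> J" "k \<in> K" "x = f j k" by blast
  obtain l where l: "l \<in> L" "infdist k L = dist k l"
    using infdist_attains_inf[OF compact_imp_closed[OF L(1)] L(2)] by metis
  have "f j l \<in> L" using L(3) l(1) j(1) by blast
  then have "infdist x L \<le> dist (f j k) (f j l)" using j(3) infdist_le by blast
  also have "\<dots> \<le> c * infdist k L" using lip[OF j(1)] l(2) by metis
  finally have 1: "infdist x L \<le> c * infdist k L" .
  have "infdist x L \<le> 0"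
  proof (rule ccontr)
    assume n: "\<not> infdist x L \<le> 0"
    show False
    proof (cases "c \<ge> 0")
      case True
      have "c * infdist k L \<le> c * infdist x L" using x(2)[OF j(2)] True by (rule mult_left_mono)
      moreover have "c * infdist x L < 1 * infdist x L" using c n by (intro mult_strict_right_mono) auto
      ultimately show ?thesis using 1 by simp
    next
      case False
      then have "c * infdist k L \<le> 0" by (simp add: mult_nonpos_nonneg infdist_nonneg)
      then show ?thesis using 1 n by simp
    qed
  qed
  then have z: "infdist z L = 0" if "z \<in> K" for z
    using x(2)[OF that] infdist_nonneg[of z L] by simp
  show ?thesis
    using z in_closed_iff_infdist_zero[OF compact_imp_closed[OF L(1)] L(2)] by blast
qed

lemma ifs_attractor_ex1:
  fixes f :: "'i \<Rightarrow> 'a::euclidean_space \<Rightarrow> 'a"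
  assumes c: "0 \<le> c" "c < 1" and J: "finite J" "J \<noteq> {}"
    and lip: "\<And>j x y. j \<in> J \<Longrightarrow> dist (f j x) (f j y) \<le> c * dist x y"
  shows "\<exists>!K. compact K \<and> K \<noteq> {} \<and> K = (\<Union>j\<in>J. f j ` K)"
proof (rule ex_ex1I)
  fix K L
  assume "compact K \<and> K \<noteq> {} \<and> K = (\<Union>j\<in>J. f j ` K)"
    and "compact L \<and> L \<noteq> {} \<and> L = (\<Union>j\<in>J. f j ` L)"
  then show "K = L"
    by (intro subset_antisym; intro ifs_attractor_subset[OF c(2) lip]) blast+
next
  define \<Phi> where "\<Phi> S = (\<Union>j\<in>J. f j ` S)" for S
  define M where "M = Max ((\<lambda>j. norm (f j 0)) ` J)"
  define R where "R = M / (1 - c)"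
  define S where "S n = (\<Phi> ^^ n) (cball 0 R)" for n
  have M: "norm (f j 0) \<le> M" if "j \<in> J" for j
    unfolding M_def using J that by (intro Max_ge) auto
  have "0 \<le> M" using J M norm_ge_zero order_trans by blast
  then have R: "0 \<le> R" "c * R + M = R" using c by (auto simp: R_def field_simps)
  have cont: "continuous_on T (f j)" if "j \<in> J" for j T
    by (rule lipschitz_on_continuous_on[where L = c]) (use lip[OF that] c in \<open>auto simp: lipschitz_on_def\<close>)
  have mono: "A \<subseteq> B \<Longrightarrow> \<Phi> A \<subseteq> \<Phi> B" for A B unfolding \<Phi>_def by blast
  have "\<Phi> (cball 0 R) \<subseteq> cball 0 R"
  proof -
    have "norm (f j x) \<le> R" if "j \<in> J" "norm x \<le> R" for j x
    proof -
      have "norm (f j x) \<le> dist (f j x) (f j 0) + norm (f j 0)"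
        using norm_triangle_ineq[of "f j x - f j 0" "f j 0"] by (simp add: dist_norm)
      also have "\<dots> \<le> c * norm x + M"
        using lip[OF that(1), of x 0] M[OF that(1)] by simp
      also have "\<dots> \<le> c * R + M" using c that by (simp add: mult_left_mono)
      finally show ?thesis using R by simp
    qed
    then show ?thesis unfolding \<Phi>_def by auto
  qed
  then have dec1: "S (Suc n) \<subseteq> S n" for n
    by (induction n) (use mono in \<open>auto simp: S_def\<close>)
  have dec: "S n \<subseteq> S m" if "m \<le> n" for m n
    using that dec1 by (rule lift_Suc_antimono_le[rotated])
  have comp: "compact (S n)" for n
    by (induction n)
      (auto simp: S_def \<Phi>_def intro!: compact_UN J compact_continuous_image cont)
  have ne: "S n \<noteq> {}" for n
    by (induction n) (use J R in \<open>auto simp: S_def \<Phi>_def\<close>)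
  define K where "K = (\<Inter>n. S n)"
  have cK: "compact K" unfolding K_def using comp by (intro compact_Inter) auto
  have nK: "K \<noteq> {}" unfolding K_def by (rule compact_nest[OF comp ne]) (use dec in auto)
  have SS: "S (Suc n) = \<Phi> (S n)" for n by (simp add: S_def)
  have "\<Phi> K \<subseteq> S (Suc n)" for n unfolding SS by (rule mono) (auto simp: K_def)
  then have "\<Phi> K \<subseteq> S n" for n using dec1 by blast
  then have 1: "\<Phi> K \<subseteq> K" by (auto simp: K_def)
  have 2: "K \<subseteq> \<Phi> K"
  proof
    fix x assume x: "x \<in> K"
    have "\<exists>j\<in>J. \<forall>n. x \<in> f j ` S n"
    proof (rule ccontr)
      assume "\<not> ?thesis"
      then obtain g where g: "\<And>j. j \<in> J \<Longrightarrow> x \<notin> f j ` S (g j)" by metis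
      define N where "N = Max (g ` J)"
      have gN: "g j \<le> N" if "j \<in> J" for j using that J by (auto simp: N_def)
      have "x \<in> \<Phi> (S N)" using x SS by (auto simp: K_def)
      then obtain j y where jy: "j \<in> J" "y \<in> S N" "x = f j y" unfolding \<Phi>_def by blast
      then show False using g[OF jy(1)] dec[OF gN[OF jy(1)]] by blast
    qed
    then obtain j where j: "j \<in> J" "\<And>n. x \<in> f j ` S n" by blast
    define T where "T n = S n \<inter> f j -` {x}" for n
    have cl: "closed (f j -` {x})"
      using cont[OF j(1), of UNIV] by (intro closed_vimage) auto
    have "(\<Inter>n. T n) \<noteq> {}"
    proof (rule compact_nest)
      show "compact (T n)" for n unfolding T_def using comp cl by (rule compact_Int_closed)
      show "T n \<noteq> {}" for n using j(2)[of n] by (auto simp: T_def)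
      show "T n \<subseteq> T m" if "m \<le> n" for m n using dec[OF that] by (auto simp: T_def)
    qed
    then obtain y where "y \<in> K" "f j y = x" by (auto simp: T_def K_def)
    then show "x \<in> \<Phi> K" using j(1) by (auto simp: \<Phi>_def)
  qed
  show "\<exists>K. compact K \<and> K \<noteq> {} \<and> K = (\<Union>j\<in>J. f j ` K)"
    using cK nK subset_antisym[OF 2 1] unfolding \<Phi>_def by blast
qed

lemma gasket_map_contraction:
  assumes "0 < \<alpha>" "\<alpha> < 1/3"
  shows "dist (gasket_map \<alpha> j x) (gasket_map \<alpha> j y) \<le> 1/2 * dist x y"
proof -
  define v where "v = x - y"
  define b where "b = norm v"
  have b2: "b\<^sup>2 = (v$1)\<^sup>2 + (v$2)\<^sup>2"
    unfolding b_def power2_norm_eq_inner by (simp add: inner_vec_def sum_2 power2_eq_square)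
  have b0: "b \<ge> 0" by (simp add: b_def)
  have *: "norm w \<le> b" if "(w$1)\<^sup>2 + (w$2)\<^sup>2 \<le> (v$1)\<^sup>2 + (v$2)\<^sup>2" for w :: "real^2"
  proof (rule power2_le_imp_le[OF _ b0])
    show "(norm w)\<^sup>2 \<le> b\<^sup>2"
      using that b2 unfolding power2_norm_eq_inner by (simp add: inner_vec_def sum_2 power2_eq_square)
  qed
  have proj: "norm (((1/4) *\<^sub>R vector [vector [1, s], vector [s, 3]] :: real^2^2) *v v) \<le> b"
    if "s * s = 3" for s :: real
  proof (rule *)
    have s2: "s * (s * t) = 3 * t" for t using that by (simp add: mult.assoc[symmetric])
    have "(v$1 / 4 + s * v$2 / 4)\<^sup>2 + (s * v$1 / 4 + 3 * v$2 / 4)\<^sup>2 + (s * v$1 - v$2)\<^sup>2 / 4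
        = (v$1)\<^sup>2 + (v$2)\<^sup>2"
      by (simp add: power2_eq_square algebra_simps that s2 add_divide_distrib diff_divide_distrib)
    moreover have "0 \<le> (s * v$1 - v$2)\<^sup>2 / 4" by simp
    ultimately have "(v$1 / 4 + s * v$2 / 4)\<^sup>2 + (s * v$1 / 4 + 3 * v$2 / 4)\<^sup>2 \<le> (v$1)\<^sup>2 + (v$2)\<^sup>2"
      by linarith
    then show "((((1/4) *\<^sub>R vector [vector [1, s], vector [s, 3]] :: real^2^2) *v v)$1)\<^sup>2
       + ((((1/4) *\<^sub>R vector [vector [1, s], vector [s, 3]] :: real^2^2) *v v)$2)\<^sup>2
       \<le> (v$1)\<^sup>2 + (v$2)\<^sup>2"
      by (simp add: matrix_vector_mult_def sum_2)
  qed
  have sc: "norm ((t *\<^sub>R A) *v v) = \<bar>t\<bar> * norm (A *v v)" for t and A :: "real^2^2"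
    by (simp add: scaleR_matrix_vector_assoc[symmetric])
  have half: "t * norm w \<le> 1/2 * b" if "0 \<le> t" "t \<le> 1/2" "norm w \<le> b" for t and w :: "real^2"
    using that by (intro mult_mono) auto
  have "norm (gasket_matrix \<alpha> j *v v) \<le> 1/2 * b"
  proof -
    consider "j = 1 \<or> j = 2 \<or> j = 3" | "j = 4" | "j = 5" | "j \<notin> {1,2,3,4,5}" by auto
    then show ?thesis
    proof cases
      case 1
      then have "norm (gasket_matrix \<alpha> j *v v) = (1 - \<alpha>) / 2 * norm v"
        using assms unfolding gasket_matrix_def by (simp only: sc if_True) simp
      then show ?thesis using half[of "(1 - \<alpha>)/2" v] assms by (simp add: b_def)
    next
      case 2
      have "gasket_matrix \<alpha> j = \<alpha> *\<^sub>R ((1/4) *\<^sub>R vector [vector [1, - sqrt 3], vector [- sqrt 3, 3]])"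
        using 2 by (simp add: gasket_matrix_def)
      then show ?thesis using half[OF _ _ proj[of "- sqrt 3"], of \<alpha>] assms by (simp only: sc) simp
    next
      case 3
      have "norm (vector [vector [1, 0], vector [0, 0]] *v v :: real^2) \<le> b"
        by (rule *) (simp add: matrix_vector_mult_def sum_2)
      moreover have "gasket_matrix \<alpha> j = \<alpha> *\<^sub>R vector [vector [1, 0], vector [0, 0]]"
        using 3 by (simp add: gasket_matrix_def)
      ultimately show ?thesis using half[of \<alpha>] assms by (simp only: sc) simp
    next
      case 4
      have "gasket_matrix \<alpha> j = \<alpha> *\<^sub>R ((1/4) *\<^sub>R vector [vector [1, sqrt 3], vector [sqrt 3, 3]])"
        using 4 by (simp add: gasket_matrix_def)
      then show ?thesis using half[OF _ _ proj[of "sqrt 3"], of \<alpha>] assms by (simp only: sc) simp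
    qed
  qed
  moreover have "gasket_map \<alpha> j x - gasket_map \<alpha> j y = gasket_matrix \<alpha> j *v v"
    by (simp add: gasket_map_def v_def matrix_vector_mult_diff_distrib)
  ultimately show ?thesis by (simp add: dist_norm b_def v_def)
qed

lemma stretched_gasket_ex1:
  assumes "0 < \<alpha>" "\<alpha> < 1/3"
  shows "\<exists>!K. compact K \<and> K \<noteq> {} \<and> K = (\<Union>j\<in>{1..6}. gasket_map \<alpha> j ` K)"
  by (rule ifs_attractor_ex1[where c = "1/2"]) (use gasket_map_contraction[OF assms] in auto)

lemma stretched_gasket_props:
  assumes "0 < \<alpha>" "\<alpha> < 1/3"
  shows "compact (stretched_gasket \<alpha>)" "stretched_gasket \<alpha> \<noteq> {}"
    "stretched_gasket \<alpha> = (\<Union>j\<in>{1..6}. gasket_map \<alpha> j ` stretched_gasket \<alpha>)"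
  using theI'[OF stretched_gasket_ex1[OF assms], folded stretched_gasket_def] by blast+

end

theory Submission imports Defs begin

text \<open>The cells \<open>F\<^sub>4(K), F\<^sub>5(K), F\<^sub>6(K)\<close> lie on line segments, which are null sets because
  \<open>\<alpha> < 1/3\<close> makes the dimension \<open>d\<close> larger than 1. The cells \<open>F\<^sub>1(K), F\<^sub>2(K), F\<^sub>3(K)\<close> are
  disjoint and compact, hence a positive distance apart, so the Hausdorff outer measure of any
  subset of \<open>K\<close> is the sum of its parts in these three cells. Finally \<open>F\<^sub>i\<close> scales distances by
  \<open>r = (1 - \<alpha>)/2\<close> for \<open>i \<le> 3\<close>, where \<open>r\<^sup>d = 1/3\<close>.\<close>

section \<open>Hausdorff measure\<close>

lemma hausdorff_premeasure_le:
  assumes "A \<subseteq> (\<Union>i. U i)" "\<And>i. bounded (U i)" "\<And>i. diameter (U i) \<le> \<delta>"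
  shows "hausdorff_premeasure s \<delta> A \<le> (\<Sum>i. diameter_pow s (U i))"
  unfolding hausdorff_premeasure_def by (rule INF_lower) (use assms in auto)

lemma hausdorff_premeasure_greatest:
  assumes "\<And>U. A \<subseteq> (\<Union>i. U i) \<Longrightarrow> (\<And>i. bounded (U i)) \<Longrightarrow> (\<And>i. diameter (U i) \<le> \<delta>)
    \<Longrightarrow> X \<le> (\<Sum>i. diameter_pow s (U i))"
  shows "X \<le> hausdorff_premeasure s \<delta> A"
  unfolding hausdorff_premeasure_def by (rule INF_greatest) (use assms in auto)

lemma hausdorff_premeasure_less_cover:
  assumes "hausdorff_premeasure s \<delta> A < c"
  obtains U where "A \<subseteq> (\<Union>i. U i)" "\<And>i. bounded (U i)" "\<And>i. diameter (U i) \<le> \<delta>"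
    "(\<Sum>i. diameter_pow s (U i)) < c"
  using assms unfolding hausdorff_premeasure_def INF_less_iff by auto

lemma hausdorff_premeasure_le_measure:
  "0 < \<delta> \<Longrightarrow> hausdorff_premeasure s \<delta> A \<le> hausdorff_measure s A"
  unfolding hausdorff_measure_def by (rule SUP_upper) simp

lemma hausdorff_measure_least:
  "(\<And>\<delta>. 0 < \<delta> \<Longrightarrow> hausdorff_premeasure s \<delta> A \<le> X) \<Longrightarrow> hausdorff_measure s A \<le> X"
  unfolding hausdorff_measure_def by (rule SUP_least) simp

text \<open>A smaller mesh admits fewer covers, so the infimum can only grow; scales may therefore
  be shrunk at will in lower bounds.\<close>

lemma hausdorff_premeasure_antimono:
  "\<delta> \<le> \<epsilon> \<Longrightarrow> hausdorff_premeasure s \<epsilon> A \<le> hausdorff_premeasure s \<delta> A"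
  by (rule hausdorff_premeasure_greatest, rule hausdorff_premeasure_le) (auto intro: order_trans)

lemma hausdorff_premeasure_mono:
  "A \<subseteq> B \<Longrightarrow> hausdorff_premeasure s \<delta> A \<le> hausdorff_premeasure s \<delta> B"
  by (rule hausdorff_premeasure_greatest, rule hausdorff_premeasure_le) auto

lemma hausdorff_measure_mono:
  assumes "A \<subseteq> B" shows "hausdorff_measure s A \<le> hausdorff_measure s B"
  by (intro hausdorff_measure_least order_trans[OF hausdorff_premeasure_mono[OF assms]]
      hausdorff_premeasure_le_measure)

lemma diameter_pow_empty [simp]: "diameter_pow s {} = 0"
  by (simp add: diameter_pow_def)

section \<open>Finite subadditivity\<close>

text \<open>Near-optimal covers of \<open>A\<close> and \<open>B\<close>, each with error
  \<open>e/2\<close>, are merged into one cover of the union. With \<open>0 < \<delta>\<close> the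
  empty sets used as padding meet the mesh bound.\<close>

lemma hausdorff_premeasure_Un_le:
  assumes "0 < \<delta>"
  shows "hausdorff_premeasure s \<delta> (A \<union> B) \<le> hausdorff_premeasure s \<delta> A + hausdorff_premeasure s \<delta> B"
proof (rule ennreal_le_epsilon)
  fix e :: real
  assume fin: "hausdorff_premeasure s \<delta> A + hausdorff_premeasure s \<delta> B < top" and e: "0 < e"
  \<comment> \<open>In \<open>ennreal\<close>, adding \<open>e/2\<close> increases a value strictly
    only if that value is finite.\<close>
  have "hausdorff_premeasure s \<delta> S < hausdorff_premeasure s \<delta> S + ennreal (e/2)"
    if "hausdorff_premeasure s \<delta> S < top" for S :: "'a set"
    using ennreal_add_left_cancel_less[of "hausdorff_premeasure s \<delta> S" 0 "ennreal (e/2)"] that e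
    by (simp add: less_top)
  note less = hausdorff_premeasure_less_cover[OF this]
  obtain U where U: "A \<subseteq> (\<Union>i. U i)" "\<And>i. bounded (U i)" "\<And>i. diameter (U i) \<le> \<delta>"
    "(\<Sum>i. diameter_pow s (U i)) < hausdorff_premeasure s \<delta> A + ennreal (e/2)"
    using less[of A] fin by (auto simp: less_top)
  obtain V where V: "B \<subseteq> (\<Union>i. V i)" "\<And>i. bounded (V i)" "\<And>i. diameter (V i) \<le> \<delta>"
    "(\<Sum>i. diameter_pow s (V i)) < hausdorff_premeasure s \<delta> B + ennreal (e/2)"
    using less[of B] fin by (auto simp: less_top)
  \<comment> \<open>Rows 0 and 1 hold the two covers and all other rows are empty; \<open>X\<close>
    lists this array as a sequence, so the sum over \<open>X\<close> splits by rows.\<close>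
  define W where "W m n = (if m = 0 then U n else if m = 1 then V n else {})" for m n :: nat
  define X where "X k = case_prod W (prod_decode k)" for k
  have X: "X (prod_encode (m, n)) = W m n" for m n by (simp add: X_def)
  have "hausdorff_premeasure s \<delta> (A \<union> B) \<le> (\<Sum>k. diameter_pow s (X k))"
  proof (rule hausdorff_premeasure_le)
    have W: "W m n \<subseteq> (\<Union>k. X k)" for m n
      using X[of m n] by blast
    show "A \<union> B \<subseteq> (\<Union>k. X k)"
      using U(1) V(1) W[of 0] W[of 1] unfolding W_def by fastforce
    show "bounded (X k)" "diameter (X k) \<le> \<delta>" for k
      using U V assms by (auto simp: X_def W_def split: prod.split)
  qed
  also have "\<dots> = (\<Sum>m. \<Sum>n. diameter_pow s (W m n))"
    using suminf_ennreal_2dimen[of "\<lambda>m. \<Sum>n. diameter_pow s (W m n)" "\<lambda>(m, n). diameter_pow s (W m n)"]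
    by (simp add: X_def comp_def case_prod_beta)
  also have "\<dots> = (\<Sum>m\<in>{0,1}. \<Sum>n. diameter_pow s (W m n))"
    by (rule suminf_finite) (auto simp: W_def)
  also have "\<dots> = (\<Sum>n. diameter_pow s (U n)) + (\<Sum>n. diameter_pow s (V n))"
    by (simp add: W_def)
  also have "\<dots> \<le> (hausdorff_premeasure s \<delta> A + ennreal (e/2)) + (hausdorff_premeasure s \<delta> B + ennreal (e/2))"
    using U(4) V(4) by (intro add_mono) auto
  also have "\<dots> = hausdorff_premeasure s \<delta> A + hausdorff_premeasure s \<delta> B + (ennreal (e/2) + ennreal (e/2))"
    by (simp only: ac_simps)
  also have "ennreal (e/2) + ennreal (e/2) = ennreal e"
    using e by (simp flip: ennreal_plus)
  finally show "hausdorff_premeasure s \<delta> (A \<union> B)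
    \<le> hausdorff_premeasure s \<delta> A + hausdorff_premeasure s \<delta> B + ennreal e" .
qed

lemma hausdorff_measure_Un_le:
  "hausdorff_measure s (A \<union> B) \<le> hausdorff_measure s A + hausdorff_measure s B"
  by (intro hausdorff_measure_least order_trans[OF hausdorff_premeasure_Un_le] add_mono
      hausdorff_premeasure_le_measure)

text \<open>This removes the three edge cells in the final computation.\<close>

lemma hausdorff_measure_Un_null:
  assumes "hausdorff_measure s N = 0"
  shows "hausdorff_measure s (A \<union> N) = hausdorff_measure s A"
proof (rule antisym)
  show "hausdorff_measure s (A \<union> N) \<le> hausdorff_measure s A"
    using hausdorff_measure_Un_le[of s A N] assms by simp
qed (simp add: hausdorff_measure_mono)

section \<open>Additivity on sets at positive distance\<close>

text \<open>A set of diameter below \<open>\<epsilon>\<close> cannot meet both \<open>A\<close> and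
  \<open>B\<close>, so a cover of the union splits into a cover of \<open>A\<close> and a cover of
  \<open>B\<close> that share no nonempty member.\<close>

lemma hausdorff_premeasure_Un_separated:
  assumes sep: "\<And>a b. a \<in> A \<Longrightarrow> b \<in> B \<Longrightarrow> \<epsilon> \<le> dist a b" and "\<delta> < \<epsilon>"
  shows "hausdorff_premeasure s \<delta> A + hausdorff_premeasure s \<delta> B \<le> hausdorff_premeasure s \<delta> (A \<union> B)"
proof (rule hausdorff_premeasure_greatest)
  fix U :: "nat \<Rightarrow> 'a set"
  assume U: "A \<union> B \<subseteq> (\<Union>i. U i)" "\<And>i. bounded (U i)" "\<And>i. diameter (U i) \<le> \<delta>"
  \<comment> \<open>Members that miss \<open>S\<close> become empty instead of being dropped: the
    indexing by \<open>nat\<close> stays and they cost 0.\<close>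
  define V where "V S i = (if U i \<inter> S = {} then {} else U i)" for S i
  have V: "hausdorff_premeasure s \<delta> S \<le> (\<Sum>i. diameter_pow s (V S i))" if "S \<subseteq> A \<union> B" for S
  proof (rule hausdorff_premeasure_le)
    show "S \<subseteq> (\<Union>i. V S i)" using that U(1) by (fastforce simp: V_def)
    have "0 \<le> \<delta>" using diameter_ge_0[OF U(2)] U(3) order_trans by blast
    then show "bounded (V S i)" "diameter (V S i) \<le> \<delta>" for i using U by (auto simp: V_def)
  qed
  have "U i \<inter> A = {} \<or> U i \<inter> B = {}" for i
  proof (rule ccontr)
    assume "\<not> ?thesis"
    then obtain a b where "a \<in> U i" "a \<in> A" "b \<in> U i" "b \<in> B" by blast
    then show False
      using sep[of a b] diameter_bounded_bound[OF U(2), of a i b] U(3)[of i] \<open>\<delta> < \<epsilon>\<close> by linarith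
  qed
  then have "diameter_pow s (V A i) + diameter_pow s (V B i) \<le> diameter_pow s (U i)" for i
    by (auto simp: V_def)
  then have "(\<Sum>i. diameter_pow s (V A i)) + (\<Sum>i. diameter_pow s (V B i)) \<le> (\<Sum>i. diameter_pow s (U i))"
    by (subst suminf_add) (auto intro: suminf_le)
  moreover have "hausdorff_premeasure s \<delta> A + hausdorff_premeasure s \<delta> B
      \<le> (\<Sum>i. diameter_pow s (V A i)) + (\<Sum>i. diameter_pow s (V B i))"
    by (intro add_mono V) auto
  ultimately show "hausdorff_premeasure s \<delta> A + hausdorff_premeasure s \<delta> B \<le> (\<Sum>i. diameter_pow s (U i))"
    by (rule order_trans[rotated])
qed

lemma hausdorff_measure_Un_separated:
  assumes \<epsilon>: "0 < \<epsilon>" and sep: "\<And>a b. a \<in> A \<Longrightarrow> b \<in> B \<Longrightarrow> \<epsilon> \<le> dist a b"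
  shows "hausdorff_measure s (A \<union> B) = hausdorff_measure s A + hausdorff_measure s B"
proof (rule antisym[OF hausdorff_measure_Un_le])
  \<comment> \<open>Two independent scales are allowed, so that the two suprema can be taken one
    after the other; the common refinement \<open>\<eta>\<close> lies below
    \<open>\<epsilon>\<close>.\<close>
  have "hausdorff_premeasure s \<delta> A + hausdorff_premeasure s \<delta>' B \<le> hausdorff_measure s (A \<union> B)"
    if "0 < \<delta>" "0 < \<delta>'" for \<delta> \<delta>'
  proof -
    define \<eta> where "\<eta> = min (\<epsilon>/2) (min \<delta> \<delta>')"
    have "0 < \<eta>" "\<eta> < \<epsilon>" "\<eta> \<le> \<delta>" "\<eta> \<le> \<delta>'" using that \<epsilon> by (auto simp: \<eta>_def)
    then have "hausdorff_premeasure s \<delta> A + hausdorff_premeasure s \<delta>' B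
        \<le> hausdorff_premeasure s \<eta> A + hausdorff_premeasure s \<eta> B"
      by (intro add_mono hausdorff_premeasure_antimono)
    also have "\<dots> \<le> hausdorff_premeasure s \<eta> (A \<union> B)"
      by (rule hausdorff_premeasure_Un_separated[OF sep \<open>\<eta> < \<epsilon>\<close>])
    also have "\<dots> \<le> hausdorff_measure s (A \<union> B)"
      by (rule hausdorff_premeasure_le_measure) fact
    finally show ?thesis .
  qed
  then show "hausdorff_measure s A + hausdorff_measure s B \<le> hausdorff_measure s (A \<union> B)"
    unfolding hausdorff_measure_def[of s A] hausdorff_measure_def[of s B]
    by (subst ennreal_SUP_add_left[symmetric], simp, intro SUP_least)
      (subst ennreal_SUP_add_right, simp, intro SUP_least, auto)
qed

section \<open>Lipschitz images and similarities\<close>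

lemma bounded_lipschitz_image:
  assumes "c-lipschitz_on S f" "bounded S"
  shows "bounded (f ` S)"
proof -
  obtain e where e: "\<And>x y. x \<in> S \<Longrightarrow> y \<in> S \<Longrightarrow> dist x y \<le> e"
    using assms(2) unfolding bounded_two_points by blast
  have "dist (f x) (f y) \<le> c * e" if "x \<in> S" "y \<in> S" for x y
    using lipschitz_onD[OF assms(1) that] mult_left_mono[OF e[OF that] lipschitz_on_nonneg[OF assms(1)]]
    by linarith
  then show ?thesis unfolding bounded_two_points by blast
qed

lemma diameter_image_le:
  assumes "c-lipschitz_on S f" "bounded S"
  shows "diameter (f ` S) \<le> c * diameter S"
proof (cases "S = {}")
  case False
  have "dist (f x) (f y) \<le> c * diameter S" if "x \<in> S" "y \<in> S" for x y
  proof -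
    have "dist (f x) (f y) \<le> c * dist x y" using assms(1) that by (rule lipschitz_onD)
    also have "\<dots> \<le> c * diameter S"
      using diameter_bounded_bound[OF assms(2) that] lipschitz_on_nonneg[OF assms(1)]
      by (rule mult_left_mono)
    finally show ?thesis .
  qed
  then show ?thesis using False unfolding diameter_def[of "f ` S"]
    by (auto intro!: cSUP_least)
qed simp

lemma diameter_pow_image_le:
  assumes "c-lipschitz_on S f" "bounded S" "0 < s"
  shows "diameter_pow s (f ` S) \<le> ennreal (c powr s) * diameter_pow s S"
proof -
  have "diameter (f ` S) powr s \<le> (c * diameter S) powr s"
    using assms by (intro powr_mono2 diameter_image_le diameter_ge_0 bounded_lipschitz_image) auto
  also have "\<dots> = c powr s * diameter S powr s"
    using lipschitz_on_nonneg[OF assms(1)] by (simp add: powr_mult diameter_ge_0 assms(2))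
  finally show ?thesis
    using assms(3) by (auto simp: diameter_pow_def simp flip: ennreal_mult)
qed

lemma diameter_pow_mono:
  "S \<subseteq> T \<Longrightarrow> bounded T \<Longrightarrow> 0 < s \<Longrightarrow> diameter_pow s S \<le> diameter_pow s T"
  by (auto simp: diameter_pow_def intro!: ennreal_leI powr_mono2 diameter_subset diameter_ge_0
      dest: bounded_subset)

text \<open>Each member of a cover of \<open>A\<close> is cut down to \<open>A\<close>, where
  \<open>f\<close> is Lipschitz, and then mapped; diameters grow by a factor of at most
  \<open>c\<close>, so the mesh becomes \<open>c * \<delta>\<close>.\<close>

lemma hausdorff_premeasure_lipschitz_image:
  fixes f :: "'a::metric_space \<Rightarrow> 'b::metric_space"
  assumes f: "c-lipschitz_on A f" and c: "0 < c" and s: "0 < s"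
  shows "hausdorff_premeasure s (c * \<delta>) (f ` A) \<le> ennreal (c powr s) * hausdorff_premeasure s \<delta> A"
proof -
  \<comment> \<open>The factor moves to the left, so that the infimum over covers of
    \<open>A\<close> stands alone and can be bounded cover by cover.\<close>
  have "ennreal (c powr - s) * hausdorff_premeasure s (c * \<delta>) (f ` A) \<le> hausdorff_premeasure s \<delta> A"
  proof (rule hausdorff_premeasure_greatest)
    fix U :: "nat \<Rightarrow> 'a set"
    assume U: "A \<subseteq> (\<Union>i. U i)" "\<And>i. bounded (U i)" "\<And>i. diameter (U i) \<le> \<delta>"
    have lip: "c-lipschitz_on (U i \<inter> A) f" for i by (rule lipschitz_on_subset[OF f]) auto
    have bd: "bounded (U i \<inter> A)" for i using U(2) by (rule bounded_subset) auto
    have "hausdorff_premeasure s (c * \<delta>) (f ` A) \<le> (\<Sum>i. diameter_pow s (f ` (U i \<inter> A)))"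
    proof (rule hausdorff_premeasure_le)
      show "f ` A \<subseteq> (\<Union>i. f ` (U i \<inter> A))" using U(1) by blast
      show "bounded (f ` (U i \<inter> A))" for i
        using lip bd by (rule bounded_lipschitz_image)
      have "diameter (f ` (U i \<inter> A)) \<le> c * diameter (U i \<inter> A)" for i
        by (rule diameter_image_le[OF lip bd])
      also have "\<dots> i \<le> c * \<delta>" for i
        using c U(3)[of i] diameter_subset[OF _ U(2), of "U i \<inter> A" i] by (intro mult_left_mono) auto
      finally show "diameter (f ` (U i \<inter> A)) \<le> c * \<delta>" for i .
    qed
    also have "\<dots> \<le> (\<Sum>i. ennreal (c powr s) * diameter_pow s (U i))"
    proof (intro suminf_le)
      show "diameter_pow s (f ` (U i \<inter> A)) \<le> ennreal (c powr s) * diameter_pow s (U i)" for i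
        using diameter_pow_image_le[OF lip bd s, of i]
          mult_left_mono[OF diameter_pow_mono[OF _ U(2) s, of "U i \<inter> A" i], of "ennreal (c powr s)"]
        by auto
    qed auto
    also have "\<dots> = ennreal (c powr s) * (\<Sum>i. diameter_pow s (U i))" by simp
    finally have "ennreal (c powr - s) * hausdorff_premeasure s (c * \<delta>) (f ` A)
        \<le> ennreal (c powr - s) * (ennreal (c powr s) * (\<Sum>i. diameter_pow s (U i)))"
      by (intro mult_left_mono) auto
    then show "ennreal (c powr - s) * hausdorff_premeasure s (c * \<delta>) (f ` A) \<le> (\<Sum>i. diameter_pow s (U i))"
      using c by (simp add: mult.assoc[symmetric] ennreal_mult[symmetric] powr_add[symmetric])
  qed
  then have "ennreal (c powr s) * (ennreal (c powr - s) * hausdorff_premeasure s (c * \<delta>) (f ` A))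
      \<le> ennreal (c powr s) * hausdorff_premeasure s \<delta> A"
    by (intro mult_left_mono) auto
  then show ?thesis
    using c by (simp add: mult.assoc[symmetric] ennreal_mult[symmetric] powr_add[symmetric])
qed

lemma hausdorff_measure_lipschitz_image:
  assumes "c-lipschitz_on A f" and c: "0 < c" and "0 < s"
  shows "hausdorff_measure s (f ` A) \<le> ennreal (c powr s) * hausdorff_measure s A"
proof (rule hausdorff_measure_least)
  fix \<delta> :: real assume "0 < \<delta>"
  have "hausdorff_premeasure s \<delta> (f ` A) \<le> ennreal (c powr s) * hausdorff_premeasure s (\<delta> / c) A"
    using hausdorff_premeasure_lipschitz_image[OF assms, of "\<delta> / c"] c by simp
  also have "\<dots> \<le> ennreal (c powr s) * hausdorff_measure s A"
    using \<open>0 < \<delta>\<close> c by (intro mult_left_mono hausdorff_premeasure_le_measure) auto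
  finally show "hausdorff_premeasure s \<delta> (f ` A) \<le> ennreal (c powr s) * hausdorff_measure s A" .
qed

text \<open>The inverse of a similarity of ratio \<open>c\<close> is Lipschitz with constant
  \<open>1/c\<close>, so the Lipschitz bound applies in both directions.\<close>

lemma hausdorff_measure_similarity_image:
  assumes f: "\<And>x y. x \<in> A \<Longrightarrow> y \<in> A \<Longrightarrow> dist (f x) (f y) = c * dist x y" and c: "0 < c" and s: "0 < s"
  shows "hausdorff_measure s (f ` A) = ennreal (c powr s) * hausdorff_measure s A"
proof (rule antisym)
  show "hausdorff_measure s (f ` A) \<le> ennreal (c powr s) * hausdorff_measure s A"
    using c s by (intro hausdorff_measure_lipschitz_image lipschitz_onI) (auto simp: f)
  have inj: "inj_on f A"
    using f c by (intro inj_onI) (metis dist_eq_0_iff less_irrefl mult_eq_0_iff)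
  have "(1/c)-lipschitz_on (f ` A) (inv_into A f)"
    using c by (intro lipschitz_onI) (auto simp: inv_into_f_f[OF inj] f)
  then have "hausdorff_measure s (inv_into A f ` f ` A) \<le> ennreal ((1/c) powr s) * hausdorff_measure s (f ` A)"
    using c s by (intro hausdorff_measure_lipschitz_image) auto
  then have "hausdorff_measure s A \<le> ennreal ((1/c) powr s) * hausdorff_measure s (f ` A)"
    by (simp add: inv_into_image_cancel[OF inj])
  then have "ennreal (c powr s) * hausdorff_measure s A
      \<le> ennreal (c powr s) * (ennreal ((1/c) powr s) * hausdorff_measure s (f ` A))"
    by (intro mult_left_mono) auto
  also have "\<dots> = hausdorff_measure s (f ` A)"
    using c by (simp add: mult.assoc[symmetric] ennreal_mult[symmetric] powr_mult[symmetric])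
  finally show "ennreal (c powr s) * hausdorff_measure s A \<le> hausdorff_measure s (f ` A)" .
qed

section \<open>Segments are null above dimension 1\<close>

text \<open>Covering by \<open>n\<close> intervals of length \<open>1/n\<close> costs
  \<open>n powr (1 - s)\<close>, which tends to 0.\<close>

lemma hausdorff_measure_unit_interval:
  assumes s: "1 < s"
  shows "hausdorff_measure s {0..1::real} = 0"
proof -
  have "hausdorff_premeasure s \<delta> {0..1::real} \<le> 0" if \<delta>: "0 < \<delta>" for \<delta>
  proof (rule tendsto_lowerbound)
    show "(\<lambda>n. ennreal (real n powr (1 - s))) \<longlonglongrightarrow> 0"
      using s tendsto_ennrealI[OF tendsto_neg_powr[OF _ filterlim_real_sequentially], of "1 - s"] by simp
    have "hausdorff_premeasure s \<delta> {0..1::real} \<le> ennreal (real n powr (1 - s))"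
      if n: "n > nat \<lceil>1 / \<delta>\<rceil>" for n
    proof -
      have n0: "0 < n" using n by simp
      have nd: "1 / real n \<le> \<delta>"
      proof -
        have "1 / \<delta> \<le> real n" using n by linarith
        then show ?thesis using \<delta> n0 by (simp add: field_simps)
      qed
      define U where "U i = (if i < n then {real i / n .. (real i + 1) / n} else {})" for i
      have dU: "diameter (U i) = (if i < n then 1 / n else 0)" for i
        using n0 by (auto simp: U_def diff_divide_distrib[symmetric] divide_less_cancel)
      have "hausdorff_premeasure s \<delta> {0..1::real} \<le> (\<Sum>i. diameter_pow s (U i))"
      proof (rule hausdorff_premeasure_le)
        show "{0..1} \<subseteq> (\<Union>i. U i)"
        proof
          fix x :: real assume x: "x \<in> {0..1}"
          show "x \<in> (\<Union>i. U i)"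
          \<comment> \<open>For \<open>x = 1\<close> the floor would give the index
            \<open>n\<close>, one past the last interval.\<close>
          proof (cases "x = 1")
            case True
            then have "x \<in> U (n - 1)" using n0 by (auto simp: U_def of_nat_diff)
            then show ?thesis by blast
          next
            case False
            define i where "i = nat \<lfloor>x * n\<rfloor>"
            have i: "real i \<le> x * n" "x * n < real i + 1"
              using x by (auto simp: i_def)
            have "x * n < 1 * real n" using False x n0 by (intro mult_strict_right_mono) auto
            then have "i < n" using i by simp
            then have "x \<in> U i" using i n0 by (auto simp: U_def field_simps)
            then show ?thesis by blast
          qed
        qed
        show "bounded (U i)" for i by (simp add: U_def)
        show "diameter (U i) \<le> \<delta>" for i unfolding dU using nd \<delta> by simp
      qed
      also have "\<dots> = (\<Sum>i<n. diameter_pow s (U i))"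
        by (rule suminf_finite) (auto simp: U_def)
      also have "\<dots> \<le> (\<Sum>i<n. ennreal ((1 / n) powr s))"
        by (intro sum_mono) (use s in \<open>auto simp: diameter_pow_def dU\<close>)
      also have "\<dots> = ennreal (real n * (1 / n) powr s)"
        by (simp add: ennreal_mult ennreal_of_nat_eq_real_of_nat)
      also have "real n * (1 / n) powr s = real n powr (1 - s)"
        using n0 by (simp add: powr_divide powr_diff)
      finally show ?thesis .
    qed
    then show "\<forall>\<^sub>F n in sequentially. hausdorff_premeasure s \<delta> {0..1::real} \<le> ennreal (real n powr (1 - s))"
      by (rule eventually_sequentiallyI[of "Suc (nat \<lceil>1 / \<delta>\<rceil>)"]) auto
  qed simp
  then have "hausdorff_measure s {0..1::real} \<le> 0" by (rule hausdorff_measure_least)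
  then show ?thesis by simp
qed

lemma hausdorff_measure_closed_segment:
  fixes a b :: "'a::real_normed_vector"
  assumes "1 < s"
  shows "hausdorff_measure s (closed_segment a b) = 0"
proof -
  \<comment> \<open>The summand 1 keeps the Lipschitz constant positive when
    \<open>a = b\<close>.\<close>
  have "(norm (b - a) + 1)-lipschitz_on {0..1::real} (\<lambda>u. (1 - u) *\<^sub>R a + u *\<^sub>R b)"
  proof (rule lipschitz_onI)
    fix x y :: real
    have "((1 - x) *\<^sub>R a + x *\<^sub>R b) - ((1 - y) *\<^sub>R a + y *\<^sub>R b) = (x - y) *\<^sub>R (b - a)"
      by (simp add: algebra_simps)
    then show "dist ((1 - x) *\<^sub>R a + x *\<^sub>R b) ((1 - y) *\<^sub>R a + y *\<^sub>R b) \<le> (norm (b - a) + 1) * dist x y"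
      by (simp only: dist_norm) (simp add: mult.commute[of "norm (b - a) + 1"] mult_left_mono)
  qed auto
  then have "hausdorff_measure s ((\<lambda>u. (1 - u) *\<^sub>R a + u *\<^sub>R b) ` {0..1::real})
      \<le> ennreal ((norm (b - a) + 1) powr s) * hausdorff_measure s {0..1::real}"
    using assms by (intro hausdorff_measure_lipschitz_image) (auto simp: add_nonneg_pos)
  then show ?thesis
    using assms by (simp add: closed_segment_image_interval hausdorff_measure_unit_interval)
qed

section \<open>Barycentric coordinates on the gasket\<close>

text \<open>Barycentric coordinates of the plane with respect to \<open>p\<^sub>1, p\<^sub>2, p\<^sub>3\<close>; only
  \<open>i \<in> {1, 2, 3}\<close> is meaningful. The edge map \<open>F\<^sub>j\<close> with \<open>j \<in> {4, 5, 6}\<close> maps into the line where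
  coordinate \<open>j - 3\<close> vanishes.\<close>

definition bary :: "nat \<Rightarrow> real^2 \<Rightarrow> real" where
  "bary i x = (if i = 1 then 1 - x$1 - sqrt 3 / 3 * x$2
     else if i = 2 then 2 * sqrt 3 / 3 * x$2 else x$1 - sqrt 3 / 3 * x$2)"

lemma continuous_on_bary [continuous_intros]: "continuous_on S (bary i)"
  unfolding bary_def[abs_def]
  by (cases "i = 1"; cases "i = 2") (auto intro!: continuous_intros)

lemma bary_sum: "bary 1 x + bary 2 x + bary 3 x = 1"
  by (simp add: bary_def)

lemma bary_expansion:
  "x = bary 1 x *\<^sub>R gasket_point 1 + bary 2 x *\<^sub>R gasket_point 2 + bary 3 x *\<^sub>R gasket_point 3"
  by (simp add: vec_eq_iff forall_2 bary_def gasket_point_def)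

section \<open>The maps in barycentric coordinates\<close>

lemma gasket_map_corner:
  assumes "j \<in> {1, 2, 3}"
  shows "gasket_map \<alpha> j x = ((1 - \<alpha>) / 2) *\<^sub>R (x - gasket_point j) + gasket_point j"
proof -
  have "gasket_matrix \<alpha> j = ((1 - \<alpha>) / 2) *\<^sub>R mat 1"
    using assms by (auto simp: gasket_matrix_def)
  then show ?thesis
    by (simp only: gasket_map_def scaleR_matrix_vector_assoc[symmetric] matrix_vector_mul_lid)
qed

lemma dist_gasket_map_corner:
  assumes "j \<in> {1, 2, 3}" "\<alpha> \<le> 1"
  shows "dist (gasket_map \<alpha> j x) (gasket_map \<alpha> j y) = (1 - \<alpha>) / 2 * dist x y"
proof -
  have "gasket_map \<alpha> j x - gasket_map \<alpha> j y = ((1 - \<alpha>) / 2) *\<^sub>R (x - y)"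
    by (simp add: gasket_map_corner[OF assms(1)] algebra_simps)
  then show ?thesis using assms(2) by (simp add: dist_norm)
qed

text \<open>The map is a homothety about \<open>gasket_point j\<close>, where coordinate
  \<open>j\<close> is 1 and the others vanish; the offset is
  \<open>1 - (1 - \<alpha>) / 2\<close>.\<close>

lemma bary_gasket_map_corner:
  assumes "i \<in> {1, 2, 3}" "j \<in> {1, 2, 3}"
  shows "bary i (gasket_map \<alpha> j x) = (1 - \<alpha>) / 2 * bary i x + (if i = j then (1 + \<alpha>) / 2 else 0)"
  using assms unfolding gasket_map_corner[OF assms(2)]
  by (auto simp: bary_def gasket_point_def field_simps)
    (simp_all add: mult.assoc[symmetric])

text \<open>The matrix is \<open>\<alpha>\<close> times the orthogonal projection onto the direction
  of the side opposite vertex \<open>j - 3\<close>, and \<open>gasket_point j\<close> is the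
  midpoint of that side. The triangle being equilateral, projection onto the side shares the weight
  of vertex \<open>j - 3\<close> equally between the other two vertices.\<close>

lemma bary_gasket_map_edge:
  assumes "i \<in> {1, 2, 3}" "j \<in> {4, 5, 6}"
  shows "bary i (gasket_map \<alpha> j x) =
    (if i = j - 3 then 0 else (1 - \<alpha>) / 2 + \<alpha> * (bary i x + bary (j - 3) x / 2))"
proof -
  define s where "s = sqrt 3"
  have s: "s * s = 3" "s * (s * t) = 3 * t" for t
    by (simp_all add: s_def mult.assoc[symmetric])
  have *: "((t *\<^sub>R vector [vector [a, b], vector [c, d]] :: real^2^2) *v v) $ 1 = t * (a * v$1 + b * v$2)"
    "((t *\<^sub>R vector [vector [a, b], vector [c, d]] :: real^2^2) *v v) $ 2 = t * (c * v$1 + d * v$2)"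
    for t a b c d and v :: "real^2"
    by (simp_all add: matrix_vector_mult_def sum_2 algebra_simps)
  show ?thesis
    using assms unfolding bary_def gasket_map_def gasket_matrix_def gasket_point_def s_def[symmetric]
    by (auto simp: Let_def *) (simp_all add: field_simps s)
qed

text \<open>This places the gasket inside the triangle. The argument is a minimum principle: the
  least coordinate attains its minimum over the compact gasket at some \<open>z\<close>, and
  \<open>z\<close> is the image of a point \<open>y\<close> of the gasket.\<close>

lemma bary_stretched_gasket_nonneg:
  assumes \<alpha>: "0 < \<alpha>" "\<alpha> < 1/3" and x: "x \<in> stretched_gasket \<alpha>" and i: "i \<in> {1, 2, 3}"
  shows "0 \<le> bary i x"
proof -
  define m where "m x = Min ((\<lambda>i. bary i x) ` {1, 2, 3})" for x
  have m_le: "m x \<le> bary i x" if "i \<in> {1, 2, 3}" for i x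
    unfolding m_def using that by (intro Min_le) auto
  have m_eq: "m x = min (bary 1 x) (min (bary 2 x) (bary 3 x))" for x
    by (simp add: m_def)
  have "continuous_on (stretched_gasket \<alpha>) m"
    unfolding m_eq[abs_def] by (intro continuous_intros)
  then obtain z where z: "z \<in> stretched_gasket \<alpha>" "\<And>y. y \<in> stretched_gasket \<alpha> \<Longrightarrow> m z \<le> m y"
    using continuous_attains_inf[OF stretched_gasket_props(1,2)[OF \<alpha>]] by blast
  obtain j y where j: "j \<in> {1..6}" and y: "y \<in> stretched_gasket \<alpha>" "z = gasket_map \<alpha> j y"
    using z(1) stretched_gasket_props(3)[OF \<alpha>] by blast
  have my: "m z \<le> bary k y" if "k \<in> {1, 2, 3}" for k
    using z(2)[OF y(1)] m_le[OF that] by (rule order_trans)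
  have "m z \<in> (\<lambda>i. bary i z) ` {1, 2, 3}" unfolding m_def by (rule Min_in) auto
  then obtain k where k: "k \<in> {1, 2, 3}" "m z = bary k z" by blast
  \<comment> \<open>On every cell the coordinates are at least a multiple, with factor below 1, of coordinates of
    another point of the gasket; so their minimum cannot be negative.\<close>
  have "0 \<le> m z"
  proof (rule ccontr)
    assume neg: "\<not> 0 \<le> m z"
    consider "j \<in> {1, 2, 3}" | "j \<in> {4, 5, 6}" using j by force
    then show False
    proof cases
      case 1
      have "(1 - \<alpha>) / 2 * m z \<le> (1 - \<alpha>) / 2 * bary k y"
        using my[OF k(1)] \<alpha> by (intro mult_left_mono) auto
      also have "\<dots> \<le> m z"
        using bary_gasket_map_corner[OF k(1) 1] k(2) y(2) \<alpha> by (auto split: if_splits)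
      finally have "0 \<le> (1 + \<alpha>) / 2 * m z" by (simp add: field_simps)
      then show False using neg \<alpha> by (simp add: zero_le_mult_iff)
    next
      case 2
      then have "j - 3 \<in> {1, 2, 3}" by auto
      then have *: "\<alpha> * (m z + m z / 2) \<le> \<alpha> * (bary k y + bary (j - 3) y / 2)"
        using my[OF k(1)] my[of "j - 3"] \<alpha> by (intro mult_left_mono add_mono) auto
      \<comment> \<open>This rules out \<open>k = j - 3\<close>, the coordinate that vanishes on
        this cell.\<close>
      have "m z \<noteq> 0" using neg by auto
      then have "m z = (1 - \<alpha>) / 2 + \<alpha> * (bary k y + bary (j - 3) y / 2)"
        using bary_gasket_map_edge[OF k(1) 2, of \<alpha> y] k(2) y(2) by (simp split: if_splits)
      then have "\<alpha> * (bary k y + bary (j - 3) y / 2) = m z - (1 - \<alpha>) / 2" by simp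
      also have "\<dots> \<le> m z" using \<alpha> by simp
      finally have "\<alpha> * (m z + m z / 2) \<le> m z" using * by (rule order_trans[rotated])
      then have "0 \<le> (1 - 3 / 2 * \<alpha>) * m z" by (simp add: field_simps)
      then show False using neg \<alpha> by (simp add: zero_le_mult_iff)
    qed
  qed
  then show ?thesis using z(2)[OF x] m_le[OF i, of x] by linarith
qed

lemma bary_stretched_gasket_le_1:
  assumes "0 < \<alpha>" "\<alpha> < 1/3" "x \<in> stretched_gasket \<alpha>" "i \<in> {1, 2, 3}"
  shows "bary i x \<le> 1"
  using assms(4) bary_sum[of x] bary_stretched_gasket_nonneg[OF assms(1-3), of 1]
    bary_stretched_gasket_nonneg[OF assms(1-3), of 2] bary_stretched_gasket_nonneg[OF assms(1-3), of 3]
  by auto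

lemma gasket_map_mem:
  assumes "0 < \<alpha>" "\<alpha> < 1/3" "x \<in> stretched_gasket \<alpha>" "j \<in> {1..6}"
  shows "gasket_map \<alpha> j x \<in> stretched_gasket \<alpha>"
  using stretched_gasket_props(3)[OF assms(1,2)] assms(3,4) by blast

section \<open>Position of the cells\<close>

text \<open>Coordinate \<open>i\<close> is at least \<open>(1 + \<alpha>) / 2\<close> on cell
  \<open>i\<close> and at most \<open>(1 - \<alpha>) / 2\<close> on cell \<open>j\<close>.\<close>

lemma gasket_corner_cells_disjoint:
  assumes \<alpha>: "0 < \<alpha>" "\<alpha> < 1/3" and ij: "i \<in> {1, 2, 3}" "j \<in> {1, 2, 3}" "i \<noteq> j"
  shows "gasket_map \<alpha> i ` stretched_gasket \<alpha> \<inter> gasket_map \<alpha> j ` stretched_gasket \<alpha> = {}"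
proof -
  have False if x: "x \<in> stretched_gasket \<alpha>" and y: "y \<in> stretched_gasket \<alpha>"
    and eq: "gasket_map \<alpha> i x = gasket_map \<alpha> j y" for x y
  proof -
    have "(1 - \<alpha>) / 2 * bary i x + (1 + \<alpha>) / 2 = (1 - \<alpha>) / 2 * bary i y"
      using bary_gasket_map_corner[OF ij(1) ij(1), of \<alpha> x] bary_gasket_map_corner[OF ij(1,2), of \<alpha> y]
        ij(3) eq by simp
    moreover have "0 \<le> (1 - \<alpha>) / 2 * bary i x"
      using bary_stretched_gasket_nonneg[OF \<alpha> x ij(1)] \<alpha> by simp
    moreover have "(1 - \<alpha>) / 2 * bary i y \<le> (1 - \<alpha>) / 2 * 1"
      using bary_stretched_gasket_le_1[OF \<alpha> y ij(1)] \<alpha> by (intro mult_left_mono) auto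
    ultimately show False using \<alpha> by (simp add: field_simps)
  qed
  then show ?thesis by blast
qed

text \<open>One coordinate vanishes on the cell; the other two are nonnegative with sum 1, so they
  are the weights of a point on a side of the triangle.\<close>

lemma gasket_edge_cell_subset_segment:
  assumes \<alpha>: "0 < \<alpha>" "\<alpha> < 1/3" and j: "j \<in> {4, 5, 6}"
  shows "\<exists>a b. gasket_map \<alpha> j ` stretched_gasket \<alpha> \<subseteq> closed_segment a b"
proof -
  define i where "i = j - 3"
  \<comment> \<open>\<open>a\<close> and \<open>b\<close> are the two indices in
    \<open>{1, 2, 3}\<close> other than \<open>i\<close>, in increasing order.\<close>
  define a where "a = (if i = 1 then 2 else 1 :: nat)"
  define b where "b = (if i = 3 then 2 else 3 :: nat)"
  have abi: "a \<in> {1, 2, 3}" "b \<in> {1, 2, 3}" "i \<in> {1, 2, 3}" using j by (auto simp: a_def b_def i_def)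
  have "y \<in> closed_segment (gasket_point a) (gasket_point b)"
    if y: "y \<in> gasket_map \<alpha> j ` stretched_gasket \<alpha>" for y
  proof -
    have y0: "bary i y = 0" using y bary_gasket_map_edge[OF abi(3) j] by (auto simp: i_def)
    have "y \<in> stretched_gasket \<alpha>" using y j gasket_map_mem[OF \<alpha>] by force
    then have nonneg: "0 \<le> bary a y" "0 \<le> bary b y"
      using bary_stretched_gasket_nonneg[OF \<alpha>] abi by auto
    have sum: "bary a y = 1 - bary b y"
      using bary_sum[of y] y0 abi by (auto simp: a_def b_def)
    have "y = bary a y *\<^sub>R gasket_point a + bary b y *\<^sub>R gasket_point b"
      using bary_expansion[of y] y0 abi by (auto simp: a_def b_def)
    then show ?thesis
      using nonneg sum unfolding in_segment by (intro exI[of _ "bary b y"]) auto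
  qed
  then show ?thesis by blast
qed

section \<open>The dimension\<close>

text \<open>The condition \<open>\<alpha> < 1/3\<close> says exactly that
  \<open>2 / (1 - \<alpha>) < 3\<close>.\<close>

lemma gasket_dim_gt_1:
  assumes "0 < \<alpha>" "\<alpha> < 1/3"
  shows "1 < gasket_dim \<alpha>"
proof -
  have "ln (2 / (1 - \<alpha>)) < ln 3" "0 < ln (2 / (1 - \<alpha>))"
    using assms by (auto simp: field_simps)
  then show ?thesis using assms by (simp add: gasket_dim_def ln_div)
qed

text \<open>This is the Moran equation for three similarities of ratio
  \<open>(1 - \<alpha>) / 2\<close>; it produces the factor 1/3 of the theorem.\<close>

lemma gasket_ratio_powr_dim:
  assumes "0 < \<alpha>" "\<alpha> < 1/3"
  shows "((1 - \<alpha>) / 2) powr gasket_dim \<alpha> = 1/3"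
proof -
  have "0 < ln (2 / (1 - \<alpha>))" using assms by (auto simp: field_simps)
  then have "ln 2 - ln (1 - \<alpha>) > 0" using assms by (simp add: ln_div)
  then have "gasket_dim \<alpha> * ln ((1 - \<alpha>) / 2) = - ln 3"
    using assms by (simp add: gasket_dim_def ln_div field_simps)
  then show ?thesis using assms by (simp add: powr_def exp_minus inverse_eq_divide)
qed

section \<open>Splitting the measure over the cells\<close>

theorem proposition5p8:
  fixes \<alpha> :: real and A :: "(real^2) set"
  assumes "0 < \<alpha>" and "\<alpha> < 1/3"
    and "A \<in> sets borel" and "A \<subseteq> stretched_gasket \<alpha>"
  shows "hausdorff_measure (gasket_dim \<alpha>) A =
    1/3 * (\<Sum>i\<in>{1..3}. hausdorff_measure (gasket_dim \<alpha>)
                         {x \<in> stretched_gasket \<alpha>. gasket_map \<alpha> i x \<in> A})"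
proof -
  define H where "H S = hausdorff_measure (gasket_dim \<alpha>) S" for S :: "(real^2) set"
  define F where "F j = gasket_map \<alpha> j ` stretched_gasket \<alpha>" for j
  define B where "B j = {x \<in> stretched_gasket \<alpha>. gasket_map \<alpha> j x \<in> A}" for j
  note \<alpha> = assms(1,2)
  have scale: "H (A \<inter> F j) = ennreal (1/3) * H (B j)" if j: "j \<in> {1, 2, 3}" for j
  proof -
    have "A \<inter> F j = gasket_map \<alpha> j ` B j" by (auto simp: F_def B_def)
    moreover have "H (gasket_map \<alpha> j ` B j) = ennreal (((1 - \<alpha>) / 2) powr gasket_dim \<alpha>) * H (B j)"
      unfolding H_def using \<alpha> gasket_dim_gt_1[OF \<alpha>]
      by (intro hausdorff_measure_similarity_image dist_gasket_map_corner j) auto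
    ultimately show ?thesis by (simp only: gasket_ratio_powr_dim[OF \<alpha>])
  qed
  have null: "H (A \<inter> F j) = 0" if "j \<in> {4, 5, 6}" for j
  proof -
    obtain a b where "F j \<subseteq> closed_segment a b"
      using gasket_edge_cell_subset_segment[OF \<alpha> \<open>j \<in> {4, 5, 6}\<close>] unfolding F_def by blast
    then have "H (A \<inter> F j) \<le> H (closed_segment a b)"
      unfolding H_def by (intro hausdorff_measure_mono) blast
    then show ?thesis
      unfolding H_def by (simp add: hausdorff_measure_closed_segment[OF gasket_dim_gt_1[OF \<alpha>]])
  qed
  have compact: "compact (F j)" if "j \<in> {1, 2, 3}" for j
    unfolding F_def gasket_map_corner[OF that, abs_def]
    by (intro compact_continuous_image continuous_intros stretched_gasket_props(1)[OF \<alpha>])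
  have disjoint: "F i \<inter> F j = {}" if "i \<in> {1, 2, 3}" "j \<in> {1, 2, 3}" "i \<noteq> j" for i j
    unfolding F_def by (rule gasket_corner_cells_disjoint[OF \<alpha> that])
  \<comment> \<open>The disjoint compact sets \<open>S'\<close> and \<open>T'\<close> supply the
    positive distance for their arbitrary subsets \<open>S\<close> and \<open>T\<close>.\<close>
  have additive: "H (S \<union> T) = H S + H T"
    if ST: "compact S'" "compact T'" "S' \<inter> T' = {}" "S \<subseteq> S'" "T \<subseteq> T'" for S T S' T'
  proof -
    obtain \<epsilon> where "0 < \<epsilon>" "\<forall>x\<in>S'. \<forall>y\<in>T'. \<epsilon> \<le> dist x y"
      using separate_compact_closed[OF ST(1) compact_imp_closed[OF ST(2)] ST(3)] by blast
    then show ?thesis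
      unfolding H_def using ST(4,5) by (intro hausdorff_measure_Un_separated[of \<epsilon>]) auto
  qed
  have "stretched_gasket \<alpha> = (\<Union>j\<in>{1..6}. F j)"
    unfolding F_def by (rule stretched_gasket_props(3)[OF \<alpha>])
  moreover have "{1..6} = {1, 2, 3, 4, 5, 6 :: nat}" by auto
  \<comment> \<open>The bracketing lets the edge pieces be peeled off from the right and leaves
    \<open>F 1\<close> against \<open>F 2 \<union> F 3\<close>. Overlaps of edge and corner cells do
    no harm, since the edge pieces are null.\<close>
  ultimately have "A = A \<inter> F 1 \<union> (A \<inter> F 2 \<union> A \<inter> F 3) \<union> A \<inter> F 4 \<union> A \<inter> F 5 \<union> A \<inter> F 6"
    using assms(4) by auto
  then have "H A = H (A \<inter> F 1 \<union> (A \<inter> F 2 \<union> A \<inter> F 3) \<union> A \<inter> F 4 \<union> A \<inter> F 5 \<union> A \<inter> F 6)"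
    by (rule arg_cong)
  also have "\<dots> = H (A \<inter> F 1 \<union> (A \<inter> F 2 \<union> A \<inter> F 3))"
    using null unfolding H_def by (simp add: hausdorff_measure_Un_null)
  also have "\<dots> = H (A \<inter> F 1) + H (A \<inter> F 2 \<union> A \<inter> F 3)"
    using disjoint[of 1 2] disjoint[of 1 3]
    by (intro additive[of "F 1" "F 2 \<union> F 3"] compact_Un compact) auto
  also have "H (A \<inter> F 2 \<union> A \<inter> F 3) = H (A \<inter> F 2) + H (A \<inter> F 3)"
    by (intro additive[of "F 2" "F 3"] compact disjoint) auto
  also have "H (A \<inter> F 1) + (H (A \<inter> F 2) + H (A \<inter> F 3)) = ennreal (1/3) * (H (B 1) + H (B 2) + H (B 3))"
    by (simp add: scale distrib_left add.assoc)
  also have "ennreal (1/3) = 1/3"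
    by (simp flip: divide_ennreal)
  also have "H (B 1) + H (B 2) + H (B 3) = (\<Sum>i\<in>{1..3}. H (B i))"
    by (simp add: numeral_3_eq_3 numeral_2_eq_2 add.assoc)
  finally show ?thesis unfolding H_def B_def .
qed

end
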